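(* Let $n\geq 1$ and let $\lambda=(\lambda_1,\lambda_2,\ldots)$ be a partition of $n$. Then $\lambda\in\mathcal{SP}(n)$ if and only if $\mathrm{bin}(\lambda_1)\sqcup\big(\lambda\setminus(\lambda_1)\big)$ is an odd binary partition.
   Context: A partition of $n$ is a weakly decreasing sequence $\lambda_1\ge\lambda_2\ge\cdots$ (equivalently, a finite multiset) of positive integers with sum $n$. $\lambda\sqcup\mu$ is the partition whose multiset of parts is the multiset union (multiplicities added) of the parts of $\lambda$ and $\mu$; $\lambda\setminus(\lambda_1)$ is $\lambda$ with one occurrence of its largest part $\lambda_1$ removed. For a positive integer $m$, $\mathrm{bin}(m)$ is the unique partition of $m$ into distinct powers of $2$. An odd binary partition is a partition all of whose parts are powers of $2$ (including $1$), each part that occurs having odd multiplicity. $2\lambda$ is obtained by doubling every part of $\lambda$, and $\mathrm{add}_{1,1}(\lambda)=(\lambda_1+1,\lambda_2,\ldots)$ is obtained by adding $1$ to the first (largest) part. For a set $\mathcal S$ of partitions, all these operations are applied elementwise. The semi-Pell partitions are defined recursively by $\mathcal{SP}(0)=\emptyset$, $\mathcal{SP}(1)=\{(1)\}$, and for $n\ge1$: $\mathcal{SP}(2n)=2\,\mathcal{SP}(n)$ and $\mathcal{SP}(2n+1)=\mathrm{add}_{1,1}(\mathcal{SP}(2n))\cup\big(\mathcal{SP}(2n)\sqcup(1)\big)\cup\big(\mathcal{SP}(2n-1)\sqcup(1,1)\big)$. *)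

theory Defs
  imports "HOL-Library.Multiset" "HOL-Library.Nat_Bijection"
begin

text \<open>Partitions are multisets of positive integers; the union of partitions
  \<open>\<mu> \<squnion> \<nu>\<close>, which adds multiplicities, is multiset addition \<open>\<mu> + \<nu>\<close>.\<close>

definition is_partition :: "nat \<Rightarrow> nat multiset \<Rightarrow> bool" where
  "is_partition n \<mu> \<longleftrightarrow> (\<forall>p \<in># \<mu>. p > 0) \<and> sum_mset \<mu> = n"

text \<open>\<open>Max {}\<close> is unspecified; the largest part is only used for nonempty partitions.\<close>

definition largest_part :: "nat multiset \<Rightarrow> nat" where
  "largest_part \<mu> = Max (set_mset \<mu>)"

definition remove_largest :: "nat multiset \<Rightarrow> nat multiset" where
  "remove_largest \<mu> = \<mu> - {#largest_part \<mu>#}"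

definition add_1_1 :: "nat multiset \<Rightarrow> nat multiset" where
  "add_1_1 \<mu> = add_mset (largest_part \<mu> + 1) (remove_largest \<mu>)"

definition double :: "nat multiset \<Rightarrow> nat multiset" where
  "double \<mu> = image_mset (\<lambda>p. 2 * p) \<mu>"

definition is_bin :: "nat \<Rightarrow> nat multiset \<Rightarrow> bool" where
  "is_bin m \<mu> \<longleftrightarrow> is_partition m \<mu> \<and> (\<forall>p \<in># \<mu>. (\<exists>k. p = 2 ^ k) \<and> count \<mu> p = 1)"

definition bin :: "nat \<Rightarrow> nat multiset" where
  "bin m = (THE \<mu>. is_bin m \<mu>)"

definition odd_binary_partition :: "nat multiset \<Rightarrow> bool" where
  "odd_binary_partition \<mu> \<longleftrightarrow> (\<forall>p \<in># \<mu>. (\<exists>k. p = 2 ^ k) \<and> odd (count \<mu> p))"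

function SP :: "nat \<Rightarrow> nat multiset set" where
  "SP 0 = {}"
| "SP (Suc 0) = {{#1#}}"
| "n \<ge> 1 \<Longrightarrow> SP (2 * n) = double ` SP n"
| "n \<ge> 1 \<Longrightarrow> SP (2 * n + 1) =
     add_1_1 ` SP (2 * n) \<union> (\<lambda>\<mu>. \<mu> + {#1#}) ` SP (2 * n) \<union> (\<lambda>\<mu>. \<mu> + {#1, 1#}) ` SP (2 * n - 1)"
proof -
  fix P :: bool and x :: nat
  assume a: "x = 0 \<Longrightarrow> P" "x = Suc 0 \<Longrightarrow> P"
    "\<And>n. 1 \<le> n \<Longrightarrow> x = 2 * n \<Longrightarrow> P" "\<And>n. 1 \<le> n \<Longrightarrow> x = 2 * n + 1 \<Longrightarrow> P"
  have "x = 0 \<or> x = Suc 0 \<or> (x div 2 \<ge> 1 \<and> x = 2 * (x div 2)) \<or>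
      (x div 2 \<ge> 1 \<and> x = 2 * (x div 2) + 1)"
    by linarith
  then show P using a by blast
qed (presburger | simp; fail | (drule arg_cong[of _ _ even], simp; fail))+
termination by (relation "measure id") auto

text \<open>The description defining \<^const>\<open>bin\<close> is satisfied by exactly one multiset.\<close>

lemma is_bin_mset_set: "is_bin (set_encode A) (mset_set ((\<lambda>k. 2 ^ k) ` A))" if "finite A"
proof -
  have "inj_on (\<lambda>k::nat. (2::nat) ^ k) A" by (auto simp: inj_on_def)
  then have "sum_mset (mset_set ((\<lambda>k. (2::nat) ^ k) ` A)) = set_encode A"
    using sum_unfold_sum_mset[of "\<lambda>x. x" "(\<lambda>k. (2::nat) ^ k) ` A"]
    by (simp add: set_encode_def sum.reindex)
  then show ?thesis
    using that by (auto simp: is_bin_def is_partition_def)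
qed

lemma is_bin_imp: assumes "is_bin m \<mu>"
  shows "\<mu> = mset_set ((\<lambda>k. 2 ^ k) ` set_decode m)"
proof -
  define A where "A = {k. (2::nat) ^ k \<in># \<mu>}"
  have im: "(\<lambda>k. 2 ^ k) ` A = set_mset \<mu>"
    using assms by (auto simp: A_def is_bin_def)
  have inj: "inj_on (\<lambda>k::nat. (2::nat) ^ k) A" by (auto simp: inj_on_def)
  have fin: "finite A"
    using finite_imageD[OF _ inj] im by simp
  have \<mu>: "\<mu> = mset_set ((\<lambda>k. 2 ^ k) ` A)"
    unfolding im using assms
    by (intro multiset_eqI) (auto simp: is_bin_def count_mset_set' not_in_iff)
  have "m = set_encode A"
    using is_bin_mset_set[OF fin] assms \<mu> by (auto simp: is_bin_def is_partition_def)
  then show ?thesis using \<mu> fin by simp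
qed

lemma ex1_is_bin: "\<exists>!\<mu>. is_bin m \<mu>"
  using is_bin_mset_set[of "set_decode m"] is_bin_imp by (intro ex1I) auto

lemma is_bin_bin: "is_bin m (bin m)"
  unfolding bin_def by (rule theI') (rule ex1_is_bin)

end

theory Submission
  imports Defs
begin

text \<open>Call the multiset \<open>bin(\<lambda>\<^sub>1) \<squnion> (\<lambda> \<setminus> (\<lambda>\<^sub>1))\<close> the \<^emph>\<open>expansion\<close> of \<open>\<lambda>\<close>. It has the same sum
  as \<open>\<lambda>\<close>, and each operation in the recursion for \<open>SP\<close> acts on it in a simple way: doubling \<open>\<lambda>\<close>
  doubles the expansion, because the binary digits of \<open>2m\<close> are those of \<open>m\<close> shifted
  (\<open>expansion_double\<close>); adding a part \<open>1\<close> to \<open>\<lambda>\<close> adds a part \<open>1\<close> to the expansion; and so does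
  adding \<open>1\<close> to an even largest part, since only the last binary digit changes.

  In an odd binary partition the part \<open>1\<close> has multiplicity of the same parity as the sum, and this
  multiplicity is odd or zero (\<open>odd_binary_even_iff\<close>). Hence the expansion has no part \<open>1\<close> when the
  sum is even, and such partitions are exactly the doubles of those of half the sum
  (\<open>expandable_even\<close>). When the sum is odd, the multiplicity of \<open>1\<close> is odd.
  If at least two parts \<open>1\<close> lie outside the largest part of \<open>\<lambda>\<close>, removing two of them keeps the
  multiplicity odd. Otherwise the expansion has exactly one part \<open>1\<close>, which comes either from the
  last digit of \<open>\<lambda>\<^sub>1\<close> or from a part \<open>1\<close> of \<open>\<lambda>\<close>, and removing it leaves an expansion with even sum
  (\<open>expandable_odd\<close>). So the partitions with odd binary expansion obey the recursion
  that defines \<open>SP\<close>.\<close>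

section \<open>Binary expansions of integers\<close>

lemma bin_eqI: "is_bin m \<mu> \<Longrightarrow> bin m = \<mu>"
  using is_bin_bin is_bin_imp by metis

lemma sum_mset_bin: "sum_mset (bin m) = m"
  using is_bin_bin[of m] by (simp add: is_bin_def is_partition_def)

lemma sum_mset_double: "sum_mset (double \<mu>) = 2 * sum_mset \<mu>"
  by (induction \<mu>) (auto simp: double_def)

lemma count_double: "count (double \<mu>) (2 * p) = count \<mu> p"
  by (induction \<mu>) (auto simp: double_def)

lemma one_notin_double: "1 \<notin># double \<mu>"
  by (auto simp: double_def)

lemma in_double_iff: "p \<in># double \<mu> \<longleftrightarrow> (\<exists>q. q \<in># \<mu> \<and> p = 2 * q)"
  by (auto simp: double_def)

lemma bin_double: "bin (2 * m) = double (bin m)"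
proof (rule bin_eqI)
  have b: "\<forall>p \<in># bin m. p > 0 \<and> (\<exists>k. p = 2 ^ k) \<and> count (bin m) p = 1"
    using is_bin_bin[of m] by (auto simp: is_bin_def is_partition_def)
  have "\<exists>k. 2 * q = 2 ^ k" if "q \<in># bin m" for q
    using b that by (metis power_Suc)
  then show "is_bin (2 * m) (double (bin m))"
    using b by (auto simp: is_bin_def is_partition_def in_double_iff count_double
        sum_mset_double sum_mset_bin)
qed

lemma one_notin_bin_double: "1 \<notin># bin (2 * m)"
  unfolding bin_double by (rule one_notin_double)

lemma bin_Suc_double: "bin (2 * m + 1) = add_mset 1 (bin (2 * m))"
proof (rule bin_eqI)
  have "is_bin (2 * m) (bin (2 * m))" by (rule is_bin_bin)
  then show "is_bin (2 * m + 1) (add_mset 1 (bin (2 * m)))"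
    using one_notin_bin_double[of m]
    by (auto simp: is_bin_def is_partition_def not_in_iff intro: exI[of _ 0])
qed

lemma one_in_bin_iff: "1 \<in># bin m \<longleftrightarrow> odd m"
proof (cases "even m")
  case True
  then show ?thesis using one_notin_bin_double by (auto elim!: evenE)
next
  case False
  then obtain k where "m = 2 * k + 1" by (auto elim: oddE)
  then show ?thesis using bin_Suc_double[of k] by simp
qed

section \<open>Odd binary partitions\<close>

lemma even_sum_mset_iff_even_count_one:
  fixes \<mu> :: "nat multiset"
  assumes "\<forall>p \<in># \<mu>. \<exists>k. p = 2 ^ k"
  shows "even (sum_mset \<mu>) \<longleftrightarrow> even (count \<mu> 1)"
  using assms
proof (induction \<mu>)
  case (add p \<mu>)
  then obtain k where "p = 2 ^ k" by auto
  with add show ?case by (cases k) auto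
qed simp

text \<open>The multiplicity of \<open>1\<close> has the parity of the sum, and an even multiplicity must be zero.\<close>

lemma odd_binary_even_iff:
  assumes "odd_binary_partition \<mu>"
  shows "even (sum_mset \<mu>) \<longleftrightarrow> 1 \<notin># \<mu>"
proof -
  have "even (sum_mset \<mu>) \<longleftrightarrow> even (count \<mu> 1)"
    using assms by (intro even_sum_mset_iff_even_count_one) (auto simp: odd_binary_partition_def)
  also have "\<dots> \<longleftrightarrow> 1 \<notin># \<mu>"
    using assms by (auto simp: odd_binary_partition_def not_in_iff)
  finally show ?thesis .
qed

lemma odd_binary_even_part:
  assumes "odd_binary_partition \<mu>" "p \<in># \<mu>" "p \<noteq> 1"
  shows "even p"
proof -
  obtain k where "p = 2 ^ k" using assms by (auto simp: odd_binary_partition_def)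
  with \<open>p \<noteq> 1\<close> show ?thesis by (cases k) auto
qed

lemma odd_binary_double_iff: "odd_binary_partition (double \<mu>) \<longleftrightarrow> odd_binary_partition \<mu>"
proof -
  have "(\<exists>k. 2 * q = 2 ^ k) \<longleftrightarrow> (\<exists>k. q = 2 ^ k)" for q :: nat
  proof
    assume "\<exists>k. 2 * q = 2 ^ k"
    then obtain k where k: "2 * q = 2 ^ k" by blast
    then obtain j where "k = Suc j" by (cases k) auto
    with k show "\<exists>k. q = 2 ^ k" by auto
  qed (metis power_Suc)
  moreover have "(\<forall>p \<in># double \<mu>. P p) \<longleftrightarrow> (\<forall>q \<in># \<mu>. P (2 * q))" for P
    by (auto simp: in_double_iff)
  ultimately show ?thesis
    by (simp only: odd_binary_partition_def count_double)
qed

lemma odd_binary_add_one_iff: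
  assumes "1 \<notin># \<mu>"
  shows "odd_binary_partition (add_mset 1 \<mu>) \<longleftrightarrow> odd_binary_partition \<mu>"
proof -
  have "count (add_mset 1 \<mu>) p = count \<mu> p" if "p \<in># \<mu>" for p
    using assms that by auto
  moreover have "odd (count (add_mset 1 \<mu>) 1)"
    using assms by (simp add: not_in_iff)
  moreover have "\<exists>k. (1::nat) = 2 ^ k" by (metis power_0)
  ultimately show ?thesis
    unfolding odd_binary_partition_def set_mset_add_mset_insert ball_simps(7) by simp
qed

lemma odd_binary_add_two_ones_iff:
  assumes "1 \<in># \<mu>"
  shows "odd_binary_partition (add_mset 1 (add_mset 1 \<mu>)) \<longleftrightarrow> odd_binary_partition \<mu>"
proof -
  have "odd (count (add_mset 1 (add_mset 1 \<mu>)) p) \<longleftrightarrow> odd (count \<mu> p)" for p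
    by simp
  moreover have "set_mset (add_mset 1 (add_mset 1 \<mu>)) = set_mset \<mu>"
    using assms by auto
  ultimately show ?thesis
    by (simp only: odd_binary_partition_def)
qed

section \<open>Expanding the largest part\<close>

definition expansion :: "nat multiset \<Rightarrow> nat multiset" where
  "expansion \<mu> = bin (largest_part \<mu>) + remove_largest \<mu>"

lemma largest_part_add_mset:
  assumes "\<forall>p \<in># \<rho>. p \<le> m"
  shows "largest_part (add_mset m \<rho>) = m"
  unfolding largest_part_def using assms by (intro Max_eqI) auto

lemma expansion_add_mset:
  assumes "\<forall>p \<in># \<rho>. p \<le> m"
  shows "expansion (add_mset m \<rho>) = bin m + \<rho>"
  using assms by (simp add: expansion_def remove_largest_def largest_part_add_mset)

lemma add_1_1_add_mset:
  assumes "\<forall>p \<in># \<rho>. p \<le> m"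
  shows "add_1_1 (add_mset m \<rho>) = add_mset (m + 1) \<rho>"
  using assms by (simp add: add_1_1_def remove_largest_def largest_part_add_mset)

lemma split_largest_part:
  fixes \<mu> :: "nat multiset"
  assumes "\<mu> \<noteq> {#}"
  obtains m \<rho> where "\<mu> = add_mset m \<rho>" "\<forall>p \<in># \<rho>. p \<le> m"
proof
  have "largest_part \<mu> \<in># \<mu>" using assms by (simp add: largest_part_def)
  then show "\<mu> = add_mset (largest_part \<mu>) (remove_largest \<mu>)"
    by (simp add: remove_largest_def)
  show "\<forall>p \<in># remove_largest \<mu>. p \<le> largest_part \<mu>"
    by (auto simp: remove_largest_def largest_part_def dest: in_diffD)
qed

lemma sum_mset_expansion: "\<mu> \<noteq> {#} \<Longrightarrow> sum_mset (expansion \<mu>) = sum_mset \<mu>"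
  by (erule split_largest_part) (simp add: expansion_add_mset sum_mset_bin)

lemma expansion_double:
  assumes "\<mu> \<noteq> {#}"
  shows "expansion (double \<mu>) = double (expansion \<mu>)"
proof -
  obtain m \<rho> where *: "\<mu> = add_mset m \<rho>" "\<forall>p \<in># \<rho>. p \<le> m"
    using split_largest_part[OF assms] .
  have "expansion (add_mset (2 * m) (double \<rho>)) = bin (2 * m) + double \<rho>"
    using * by (intro expansion_add_mset) (auto simp: in_double_iff)
  then show ?thesis
    using * by (simp add: expansion_add_mset bin_double) (simp add: double_def)
qed

lemma expansion_add_one:
  assumes "\<mu> \<noteq> {#}" "\<forall>p \<in># \<mu>. p > 0"
  shows "expansion (add_mset 1 \<mu>) = add_mset 1 (expansion \<mu>)"
proof -
  obtain m \<rho> where *: "\<mu> = add_mset m \<rho>" "\<forall>p \<in># \<rho>. p \<le> m"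
    using split_largest_part[OF assms(1)] .
  have "expansion (add_mset m (add_mset 1 \<rho>)) = bin m + add_mset 1 \<rho>"
    using * assms by (intro expansion_add_mset) auto
  then show ?thesis using * by (simp add: expansion_add_mset add_mset_commute)
qed

section \<open>Partitions with odd binary expansion\<close>

definition expandable :: "nat \<Rightarrow> nat multiset set" where
  "expandable n = {\<mu>. is_partition n \<mu> \<and> odd_binary_partition (expansion \<mu>)}"

lemma is_partition_nonempty: "is_partition n \<mu> \<Longrightarrow> n \<ge> 1 \<Longrightarrow> \<mu> \<noteq> {#}"
  by (auto simp: is_partition_def)

lemma one_in_expansion_iff:
  assumes "\<mu> \<in> expandable n" "n \<ge> 1"
  shows "1 \<in># expansion \<mu> \<longleftrightarrow> odd n"
  using assms odd_binary_even_iff[of "expansion \<mu>"] sum_mset_expansion[of \<mu>]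
    is_partition_nonempty[of n \<mu>]
  by (auto simp: expandable_def is_partition_def)

lemma expandable_one: "expandable 1 = {{#1#}}"
proof -
  have "\<mu> = {#1#}" if part: "is_partition 1 \<mu>" for \<mu>
  proof -
    obtain m \<rho> where *: "\<mu> = add_mset m \<rho>"
      using is_partition_nonempty[OF part] by (auto elim: split_largest_part)
    then have "\<rho> = {#}" using part by (cases \<rho>) (auto simp: is_partition_def)
    then show ?thesis using * part by (simp add: is_partition_def)
  qed
  moreover have "expansion {#1#} = {#1#}"
  proof -
    have "bin 1 = {#1#}"
      by (rule bin_eqI) (auto simp: is_bin_def is_partition_def intro: exI[of _ 0])
    then show ?thesis using expansion_add_mset[of "{#}" 1] by simp
  qed
  ultimately show ?thesis
    by (auto simp: expandable_def is_partition_def odd_binary_partition_def intro: exI[of _ 0])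
qed

text \<open>An even sum excludes the part \<open>1\<close> from the expansion. So the last binary digit of the largest
  part is zero, the other parts are even too, and the partition can be halved.\<close>

lemma expandable_even:
  assumes "n \<ge> 1"
  shows "expandable (2 * n) = double ` expandable n"
proof
  show "double ` expandable n \<subseteq> expandable (2 * n)"
    using assms is_partition_nonempty
    by (auto simp: expandable_def expansion_double odd_binary_double_iff is_partition_def
        sum_mset_double in_double_iff)
next
  show "expandable (2 * n) \<subseteq> double ` expandable n"
  proof
    fix \<mu> assume \<mu>: "\<mu> \<in> expandable (2 * n)"
    then have part: "is_partition (2 * n) \<mu>" and odd: "odd_binary_partition (expansion \<mu>)"
      by (auto simp: expandable_def)
    obtain m \<rho> where split: "\<mu> = add_mset m \<rho>" "\<forall>p \<in># \<rho>. p \<le> m"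
      using is_partition_nonempty[OF part] assms by (auto elim: split_largest_part)
    have exp: "expansion \<mu> = bin m + \<rho>" using split by (simp add: expansion_add_mset)
    have no1: "1 \<notin># bin m + \<rho>" using one_in_expansion_iff[OF \<mu>] exp assms by simp
    then have "even m" using one_in_bin_iff[of m] by auto
    moreover have "even p" if "p \<in># \<rho>" for p
      using odd_binary_even_part[OF odd, of p] that no1 exp by auto
    ultimately have even: "\<forall>p \<in># \<mu>. even p" using split by auto
    define \<nu> where "\<nu> = image_mset (\<lambda>p. p div 2) \<mu>"
    have "double \<nu> = image_mset (\<lambda>p. p) \<mu>"
      unfolding double_def \<nu>_def image_mset.compositionality
      by (rule image_mset_cong) (use even in auto)
    then have \<nu>: "\<mu> = double \<nu>" by simp
    have partn: "is_partition n \<nu>"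
      using part unfolding \<nu> by (fastforce simp: is_partition_def sum_mset_double in_double_iff)
    have "odd_binary_partition (expansion \<nu>)"
      using odd is_partition_nonempty[OF partn assms]
      unfolding \<nu> by (simp add: expansion_double odd_binary_double_iff)
    then show "\<mu> \<in> double ` expandable n"
      using \<nu> partn by (auto simp: expandable_def)
  qed
qed

text \<open>The expansion of a partition with even sum has no part \<open>1\<close>, so it stays odd binary when it
  gets one; that of a partition with odd sum has a part \<open>1\<close>, so it stays odd binary when it gets
  two more.\<close>

lemma expandable_odd_intros:
  assumes "n \<ge> 1"
  shows "\<mu> \<in> expandable (2 * n) \<Longrightarrow> add_1_1 \<mu> \<in> expandable (2 * n + 1)"
    and "\<mu> \<in> expandable (2 * n) \<Longrightarrow> \<mu> + {#1#} \<in> expandable (2 * n + 1)"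
    and "\<mu> \<in> expandable (2 * n - 1) \<Longrightarrow> \<mu> + {#1, 1#} \<in> expandable (2 * n + 1)"
proof -
  assume \<mu>: "\<mu> \<in> expandable (2 * n)"
  then have part: "is_partition (2 * n) \<mu>" and odd: "odd_binary_partition (expansion \<mu>)"
    by (auto simp: expandable_def)
  have ne: "\<mu> \<noteq> {#}" using is_partition_nonempty[OF part] assms by simp
  have no1: "1 \<notin># expansion \<mu>" using one_in_expansion_iff[OF \<mu>] assms by simp
  have odd1: "odd_binary_partition (add_mset 1 (expansion \<mu>))"
    using odd odd_binary_add_one_iff[OF no1] by blast
  have "odd_binary_partition (expansion (add_mset 1 \<mu>))"
    using odd1 ne part expansion_add_one[of \<mu>] by (simp add: is_partition_def)
  then show "\<mu> + {#1#} \<in> expandable (2 * n + 1)"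
    using part by (auto simp: expandable_def is_partition_def)
  obtain m \<rho> where split: "\<mu> = add_mset m \<rho>" "\<forall>p \<in># \<rho>. p \<le> m"
    using split_largest_part[OF ne] .
  have exp: "expansion \<mu> = bin m + \<rho>" using split by (simp add: expansion_add_mset)
  have "even m" using no1 exp one_in_bin_iff[of m] by auto
  then obtain k where k: "m = 2 * k" by (auto elim: evenE)
  have "expansion (add_mset (m + 1) \<rho>) = bin (m + 1) + \<rho>"
    using split by (intro expansion_add_mset) auto
  then have "expansion (add_1_1 \<mu>) = add_mset 1 (expansion \<mu>)"
    using split exp k bin_Suc_double[of k] by (simp add: add_1_1_add_mset)
  then show "add_1_1 \<mu> \<in> expandable (2 * n + 1)"
    using part odd1 split by (auto simp: expandable_def is_partition_def add_1_1_add_mset)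
next
  assume \<mu>: "\<mu> \<in> expandable (2 * n - 1)"
  then have part: "is_partition (2 * n - 1) \<mu>" and odd: "odd_binary_partition (expansion \<mu>)"
    by (auto simp: expandable_def)
  have ne: "\<mu> \<noteq> {#}" using is_partition_nonempty[OF part] assms by simp
  have "1 \<in># expansion \<mu>" using one_in_expansion_iff[OF \<mu>] assms by simp
  then have "odd_binary_partition (add_mset 1 (add_mset 1 (expansion \<mu>)))"
    using odd odd_binary_add_two_ones_iff by blast
  then have "odd_binary_partition (expansion (add_mset 1 (add_mset 1 \<mu>)))"
    using ne part expansion_add_one[of \<mu>] expansion_add_one[of "add_mset 1 \<mu>"]
    by (simp add: is_partition_def)
  then show "\<mu> + {#1, 1#} \<in> expandable (2 * n + 1)"
    using part assms by (auto simp: expandable_def is_partition_def)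
qed

text \<open>Which of the three operations produced a partition is read off from the multiplicity of \<open>1\<close>
  among its parts other than the largest: zero, one, or at least two.\<close>

lemma expandable_odd_cases:
  assumes "n \<ge> 1" and \<mu>: "\<mu> \<in> expandable (2 * n + 1)"
  shows "\<mu> \<in> add_1_1 ` expandable (2 * n) \<union> (\<lambda>\<mu>. \<mu> + {#1#}) ` expandable (2 * n)
      \<union> (\<lambda>\<mu>. \<mu> + {#1, 1#}) ` expandable (2 * n - 1)"
proof -
  have part: "is_partition (2 * n + 1) \<mu>" and odd: "odd_binary_partition (expansion \<mu>)"
    using \<mu> by (auto simp: expandable_def)
  obtain m \<rho> where split: "\<mu> = add_mset m \<rho>" "\<forall>p \<in># \<rho>. p \<le> m"
    using is_partition_nonempty[OF part] by (auto elim: split_largest_part)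
  have exp: "expansion \<mu> = bin m + \<rho>" using split by (simp add: expansion_add_mset)
  have one: "1 \<in># bin m + \<rho>" using one_in_expansion_iff[OF \<mu>] exp by simp
  have oddcount: "odd (count (bin m + \<rho>) 1)"
    using one odd exp by (auto simp: odd_binary_partition_def)
  consider (none) "1 \<notin># \<rho>"
    | (once) \<sigma> where "\<rho> = add_mset 1 \<sigma>" "1 \<notin># \<sigma>"
    | (more) \<sigma> where "\<rho> = add_mset 1 (add_mset 1 \<sigma>)"
  proof (cases "1 \<in># \<rho>")
    case True
    then obtain \<sigma> where "\<rho> = add_mset 1 \<sigma>" by (blast dest: multi_member_split)
    then show thesis using once more by (cases "1 \<in># \<sigma>") (auto dest: multi_member_split)
  qed (rule none)
  then show ?thesis
  proof cases
    case none
    then have "1 \<in># bin m" using one by simp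
    then have "odd m" using one_in_bin_iff by blast
    then obtain k where k: "m = 2 * k + 1" by (auto elim: oddE)
    have even: "even p" if "p \<in># \<rho>" for p
      using odd_binary_even_part[OF odd, of p] that none exp by auto
    \<comment> \<open>The other parts are even, so they stay below the largest part when that one drops to
      the even number \<open>2 * k\<close>.\<close>
    have le: "\<forall>p \<in># \<rho>. p \<le> 2 * k"
    proof
      fix p assume "p \<in># \<rho>"
      then have "even p" "p \<le> 2 * k + 1" using even split k by auto
      then show "p \<le> 2 * k" by presburger
    qed
    have "k > 0"
    proof (rule ccontr)
      assume "\<not> k > 0"
      then have "\<rho> = {#}" using le part split by (cases \<rho>) (auto simp: is_partition_def)
      then show False using \<open>\<not> k > 0\<close> part split k assms by (simp add: is_partition_def)
    qed
    have "expansion \<mu> = add_mset 1 (bin (2 * k) + \<rho>)"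
      using exp k bin_Suc_double[of k] by simp
    moreover have "1 \<notin># bin (2 * k) + \<rho>" using none one_notin_bin_double[of k] by simp
    ultimately have "odd_binary_partition (bin (2 * k) + \<rho>)"
      using odd odd_binary_add_one_iff by metis
    then have "add_mset (2 * k) \<rho> \<in> expandable (2 * n)"
      using part split k \<open>k > 0\<close> expansion_add_mset[OF le]
      by (simp add: expandable_def is_partition_def)
    moreover have "\<mu> = add_1_1 (add_mset (2 * k) \<rho>)"
      using split k add_1_1_add_mset[OF le] by simp
    ultimately show ?thesis by blast
  next
    case (once \<sigma>)
    then have "even (count (bin m) 1)" using oddcount by (simp add: not_in_iff)
    then have "1 \<notin># bin m"
      using is_bin_bin[of m] by (auto simp: is_bin_def)
    then have "1 \<notin># bin m + \<sigma>" using once by simp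
    moreover have "expansion \<mu> = add_mset 1 (bin m + \<sigma>)" using exp once by simp
    ultimately have "odd_binary_partition (bin m + \<sigma>)"
      using odd odd_binary_add_one_iff by metis
    moreover have "expansion (add_mset m \<sigma>) = bin m + \<sigma>"
      using split once by (intro expansion_add_mset) auto
    ultimately have "add_mset m \<sigma> \<in> expandable (2 * n)"
      using part split once by (simp add: expandable_def is_partition_def)
    moreover have "\<mu> = add_mset m \<sigma> + {#1#}" using split once by simp
    ultimately show ?thesis by blast
  next
    case (more \<sigma>)
    have "odd (count (bin m + \<sigma>) 1)" using oddcount more by simp
    then have "1 \<in># bin m + \<sigma>" by (metis even_zero not_in_iff)
    moreover have "expansion \<mu> = add_mset 1 (add_mset 1 (bin m + \<sigma>))" using exp more by simp
    ultimately have "odd_binary_partition (bin m + \<sigma>)"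
      using odd odd_binary_add_two_ones_iff by metis
    moreover have "expansion (add_mset m \<sigma>) = bin m + \<sigma>"
      using split more by (intro expansion_add_mset) auto
    ultimately have "add_mset m \<sigma> \<in> expandable (2 * n - 1)"
      using part split more by (auto simp: expandable_def is_partition_def)
    moreover have "\<mu> = add_mset m \<sigma> + {#1, 1#}" using split more by simp
    ultimately show ?thesis by blast
  qed
qed

lemma expandable_odd:
  assumes "n \<ge> 1"
  shows "expandable (2 * n + 1) =
    add_1_1 ` expandable (2 * n) \<union> (\<lambda>\<mu>. \<mu> + {#1#}) ` expandable (2 * n)
      \<union> (\<lambda>\<mu>. \<mu> + {#1, 1#}) ` expandable (2 * n - 1)"
  using expandable_odd_intros[OF assms] expandable_odd_cases[OF assms] by blast

lemma SP_eq_expandable: "n \<ge> 1 \<Longrightarrow> SP n = expandable n"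
proof (induction n rule: SP.induct)
  case 1
  then show ?case by simp
next
  case 2
  show ?case using expandable_one by simp
next
  case (3 n)
  then show ?case by (simp add: expandable_even)
next
  case (4 n)
  then have "SP (2 * n) = expandable (2 * n)" "SP (2 * n - 1) = expandable (2 * n - 1)"
    by auto
  then show ?case using 4(1) by (simp only: SP.simps(4) expandable_odd)
qed

theorem theorem6p2:
  fixes n :: nat and \<mu> :: "nat multiset"
  assumes "n \<ge> 1" and "is_partition n \<mu>"
  shows "\<mu> \<in> SP n \<longleftrightarrow> odd_binary_partition (bin (largest_part \<mu>) + remove_largest \<mu>)"
  using SP_eq_expandable[OF assms(1)] assms(2) by (simp add: expandable_def expansion_def)

end
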